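(* Let $n\ge 2$ and let $A_1\xrightarrow{\alpha_1}A_2\xrightarrow{\alpha_2}\cdots\xrightarrow{\alpha_{n-1}}A_n\xrightarrow{\alpha_n}A_{n+1}$ be an exact sequence of C*-algebras and C*-morphisms. For $1\le j\le n$ let $T_jC$ be the NC mapping conical telescope of the first $j$ morphisms $\alpha_1,\dots,\alpha_j$. Then $T_nC=T_{n-1}C\oplus SA_{n+1}$, and in particular $$T_nC=\mathrm{Cone}(\alpha_1)\oplus\Big(\bigoplus_{i=3}^{n+1}SA_i\Big).$$
   Context: C*-morphisms are $*$-homomorphisms. $\mathbb{I}=[0,1]$, $\mathbb{I}A=C([0,1]\to A)$; the NC cone is $CA=\{f\in\mathbb{I}A : f(0)=0\}$ and the NC suspension is $SA=\{f\in\mathbb{I}A : f(0)=f(1)=0\}$. The NC mapping cone of $\alpha:A\to B$ is $\mathrm{Cone}(\alpha)=\{a\oplus f\in A\oplus CB : f(1)=\alpha(a)\}$. The NC mapping conical telescope of $A_1\xrightarrow{\alpha_1}\cdots\xrightarrow{\alpha_j}A_{j+1}$ is $$T_jC=\{a\oplus f_2\oplus\dots\oplus f_{j+1}\in A_1\oplus CA_2\oplus\dots\oplus CA_{j+1} : f_{k+1}(1)=\alpha_k\circ\alpha_{k-1}\circ\dots\circ\alpha_1(a),\ k=1,\dots,j\},$$ so $T_1C=\mathrm{Cone}(\alpha_1)$. Exactness means $\ker\alpha_{k+1}=\operatorname{im}\alpha_k$ for $1\le k\le n-1$. Equalities are as C*-subalgebras of $A_1\oplus CA_2\oplus\dots\oplus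 CA_{n+1}$. *)

theory Defs
  imports "HOL-Analysis.Abstract_Metric_Spaces" "HOL-Algebra.Algebraic_Closure_Type"
begin

section \<open>C*-algebras\<close>

text \<open>
  C*-algebras are represented with explicit carriers, so that an exact sequence of arbitrary length
  can be indexed by natural numbers. They need not be unital (cones and suspensions are not):
  the field \<open>one\<close>, which the HOL-Algebra record for modules inherits from monoids, plays no role.
\<close>

record 'a cstar = "(complex, 'a) module" +
  star :: "'a \<Rightarrow> 'a"
  cnorm :: "'a \<Rightarrow> real"

text \<open>
  The locale \<open>Metric_space\<close> demands symmetry and nonnegativity of the metric also outside of the
  carrier, hence the default value 0 there.
\<close>

definition cdist :: "'a cstar \<Rightarrow> 'a \<Rightarrow> 'a \<Rightarrow> real" where
  "cdist A x y =
     (if x \<in> carrier A \<and> y \<in> carrier A then cnorm A (x \<ominus>\<^bsub>A\<^esub> y) else 0)"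

locale cstar_algebra =
  Module.module "ring_of_type_algebra :: complex ring" A for A :: "'a cstar" (structure) +
  assumes mult_closed: "\<lbrakk>x \<in> carrier A; y \<in> carrier A\<rbrakk> \<Longrightarrow> x \<otimes> y \<in> carrier A"
    and mult_assoc: "\<lbrakk>x \<in> carrier A; y \<in> carrier A; z \<in> carrier A\<rbrakk> \<Longrightarrow>
      (x \<otimes> y) \<otimes> z = x \<otimes> (y \<otimes> z)"
    and distrib_right: "\<lbrakk>x \<in> carrier A; y \<in> carrier A; z \<in> carrier A\<rbrakk> \<Longrightarrow>
      (x \<oplus> y) \<otimes> z = x \<otimes> z \<oplus> y \<otimes> z"
    and distrib_left: "\<lbrakk>x \<in> carrier A; y \<in> carrier A; z \<in> carrier A\<rbrakk> \<Longrightarrow>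
      z \<otimes> (x \<oplus> y) = z \<otimes> x \<oplus> z \<otimes> y"
    and smult_mult_left: "\<lbrakk>x \<in> carrier A; y \<in> carrier A\<rbrakk> \<Longrightarrow>
      (c \<odot> x) \<otimes> y = c \<odot> (x \<otimes> y)"
    and smult_mult_right: "\<lbrakk>x \<in> carrier A; y \<in> carrier A\<rbrakk> \<Longrightarrow>
      x \<otimes> (c \<odot> y) = c \<odot> (x \<otimes> y)"
    and star_closed: "x \<in> carrier A \<Longrightarrow> star A x \<in> carrier A"
    and star_star: "x \<in> carrier A \<Longrightarrow> star A (star A x) = x"
    and star_add: "\<lbrakk>x \<in> carrier A; y \<in> carrier A\<rbrakk> \<Longrightarrow>
      star A (x \<oplus> y) = star A x \<oplus> star A y"
    and star_smult: "x \<in> carrier A \<Longrightarrow> star A (c \<odot> x) = cnj c \<odot> star A x"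
    and star_mult: "\<lbrakk>x \<in> carrier A; y \<in> carrier A\<rbrakk> \<Longrightarrow>
      star A (x \<otimes> y) = star A y \<otimes> star A x"
    and norm_nonneg: "x \<in> carrier A \<Longrightarrow> 0 \<le> cnorm A x"
    and norm_eq_0_iff: "x \<in> carrier A \<Longrightarrow> cnorm A x = 0 \<longleftrightarrow> x = \<zero>"
    and norm_triangle: "\<lbrakk>x \<in> carrier A; y \<in> carrier A\<rbrakk> \<Longrightarrow>
      cnorm A (x \<oplus> y) \<le> cnorm A x + cnorm A y"
    and norm_smult: "x \<in> carrier A \<Longrightarrow> cnorm A (c \<odot> x) = cmod c * cnorm A x"
    and norm_mult: "\<lbrakk>x \<in> carrier A; y \<in> carrier A\<rbrakk> \<Longrightarrow>
      cnorm A (x \<otimes> y) \<le> cnorm A x * cnorm A y"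
    and cstar_identity: "x \<in> carrier A \<Longrightarrow> cnorm A (star A x \<otimes> x) = (cnorm A x)\<^sup>2"
    and complete: "Metric_space.mcomplete (carrier A) (cdist A)"

text \<open>C*-morphisms are *-homomorphisms; they are not required to preserve units.\<close>

definition cstar_hom :: "'a cstar \<Rightarrow> 'b cstar \<Rightarrow> ('a \<Rightarrow> 'b) set" where
  "cstar_hom A B = {h \<in> carrier A \<rightarrow> carrier B.
     (\<forall>x\<in>carrier A. \<forall>y\<in>carrier A. h (x \<oplus>\<^bsub>A\<^esub> y) = h x \<oplus>\<^bsub>B\<^esub> h y) \<and>
     (\<forall>c. \<forall>x\<in>carrier A. h (c \<odot>\<^bsub>A\<^esub> x) = c \<odot>\<^bsub>B\<^esub> h x) \<and>
     (\<forall>x\<in>carrier A. \<forall>y\<in>carrier A. h (x \<otimes>\<^bsub>A\<^esub> y) = h x \<otimes>\<^bsub>B\<^esub> h y) \<and>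
     (\<forall>x\<in>carrier A. h (star A x) = star B (h x))}"

definition cstar_iso :: "'a cstar \<Rightarrow> 'b cstar \<Rightarrow> ('a \<Rightarrow> 'b) set" where
  "cstar_iso A B = {h \<in> cstar_hom A B.
     bij_betw h (carrier A) (carrier B) \<and> (\<forall>x\<in>carrier A. cnorm B (h x) = cnorm A x)}"

definition subalg :: "'a cstar \<Rightarrow> 'a set \<Rightarrow> 'a cstar" where
  "subalg A S = A\<lparr>carrier := S\<rparr>"

section \<open>Direct sums\<close>

definition dsum_pair :: "'a cstar \<Rightarrow> 'b cstar \<Rightarrow> ('a \<times> 'b) cstar" where
  "dsum_pair A B = \<lparr>
     carrier = carrier A \<times> carrier B,
     monoid.mult = (\<lambda>(a, b) (a', b'). (a \<otimes>\<^bsub>A\<^esub> a', b \<otimes>\<^bsub>B\<^esub> b')),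
     monoid.one = undefined,
     ring.zero = (\<zero>\<^bsub>A\<^esub>, \<zero>\<^bsub>B\<^esub>),
     add = (\<lambda>(a, b) (a', b'). (a \<oplus>\<^bsub>A\<^esub> a', b \<oplus>\<^bsub>B\<^esub> b')),
     module.smult = (\<lambda>c (a, b). (c \<odot>\<^bsub>A\<^esub> a, c \<odot>\<^bsub>B\<^esub> b)),
     star = (\<lambda>(a, b). (star A a, star B b)),
     cnorm = (\<lambda>(a, b). max (cnorm A a) (cnorm B b))\<rparr>"

text \<open>The direct sum of a finite family; inserting 0 into the maximum only matters for \<open>I = {}\<close>.\<close>

definition dsum_family :: "'i set \<Rightarrow> ('i \<Rightarrow> 'a cstar) \<Rightarrow> ('i \<Rightarrow> 'a) cstar" where
  "dsum_family I A = \<lparr>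
     carrier = (\<Pi>\<^sub>E i\<in>I. carrier (A i)),
     monoid.mult = (\<lambda>x y. \<lambda>i\<in>I. x i \<otimes>\<^bsub>A i\<^esub> y i),
     monoid.one = undefined,
     ring.zero = (\<lambda>i\<in>I. \<zero>\<^bsub>A i\<^esub>),
     add = (\<lambda>x y. \<lambda>i\<in>I. x i \<oplus>\<^bsub>A i\<^esub> y i),
     module.smult = (\<lambda>c x. \<lambda>i\<in>I. c \<odot>\<^bsub>A i\<^esub> x i),
     star = (\<lambda>x. \<lambda>i\<in>I. star (A i) (x i)),
     cnorm = (\<lambda>x. Max (insert 0 ((\<lambda>i. cnorm (A i) (x i)) ` I)))\<rparr>"

section \<open>Cones, suspensions and mapping cones\<close>

text \<open>
  Elements of \<open>C([0,1] \<rightarrow> A)\<close> are functions on \<open>real\<close> that are \<open>undefined\<close> outside of \<open>[0,1]\<close>,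
  so that equality of functions is equality on \<open>[0,1]\<close>. Note that \<open>continuous_map\<close> includes
  that the values on \<open>[0,1]\<close> lie in the carrier.
\<close>

definition path_alg :: "'a cstar \<Rightarrow> (real \<Rightarrow> 'a) cstar" where
  "path_alg A = \<lparr>
     carrier = {f \<in> extensional {0..1}. continuous_map (top_of_set {0..1})
                  (Metric_space.mtopology (carrier A) (cdist A)) f},
     monoid.mult = (\<lambda>f g. \<lambda>t\<in>{0..1}. f t \<otimes>\<^bsub>A\<^esub> g t),
     monoid.one = undefined,
     ring.zero = (\<lambda>t\<in>{0..1}. \<zero>\<^bsub>A\<^esub>),
     add = (\<lambda>f g. \<lambda>t\<in>{0..1}. f t \<oplus>\<^bsub>A\<^esub> g t),
     module.smult = (\<lambda>c f. \<lambda>t\<in>{0..1}. c \<odot>\<^bsub>A\<^esub> f t),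
     star = (\<lambda>f. \<lambda>t\<in>{0..1}. star A (f t)),
     cnorm = (\<lambda>f. SUP t\<in>{0..1}. cnorm A (f t))\<rparr>"

definition cone_alg :: "'a cstar \<Rightarrow> (real \<Rightarrow> 'a) cstar" where
  "cone_alg A = subalg (path_alg A) {f \<in> carrier (path_alg A). f 0 = \<zero>\<^bsub>A\<^esub>}"

definition susp_alg :: "'a cstar \<Rightarrow> (real \<Rightarrow> 'a) cstar" where
  "susp_alg A = subalg (path_alg A) {f \<in> carrier (path_alg A). f 0 = \<zero>\<^bsub>A\<^esub> \<and> f 1 = \<zero>\<^bsub>A\<^esub>}"

definition mapping_cone :: "'a cstar \<Rightarrow> 'b cstar \<Rightarrow> ('a \<Rightarrow> 'b) \<Rightarrow> ('a \<times> (real \<Rightarrow> 'b)) cstar" where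
  "mapping_cone A B \<alpha> = subalg (dsum_pair A (cone_alg B))
     {(a, f). (a, f) \<in> carrier (dsum_pair A (cone_alg B)) \<and> f 1 = \<alpha> a}"

section \<open>Mapping conical telescopes\<close>

text \<open>\<open>comp_upto \<alpha> k\<close> is the composition \<open>\<alpha>\<^sub>k \<circ> \<dots> \<circ> \<alpha>\<^sub>1\<close>.\<close>

primrec comp_upto :: "(nat \<Rightarrow> 'a \<Rightarrow> 'a) \<Rightarrow> nat \<Rightarrow> 'a \<Rightarrow> 'a" where
  "comp_upto \<alpha> 0 = id"
| "comp_upto \<alpha> (Suc k) = \<alpha> (Suc k) \<circ> comp_upto \<alpha> k"

text \<open>
  \<open>cone_sum A m\<close> is \<open>A\<^sub>1 \<oplus> CA\<^sub>2 \<oplus> \<dots> \<oplus> CA\<^sub>m\<close>. Its elements are pairs \<open>(a, f)\<close> with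
  \<open>a \<in> A\<^sub>1\<close> and a family \<open>f\<close> indexed by \<open>{2..m}\<close>.
\<close>

definition cone_sum ::
    "(nat \<Rightarrow> 'a cstar) \<Rightarrow> nat \<Rightarrow> ('a \<times> (nat \<Rightarrow> real \<Rightarrow> 'a)) cstar" where
  "cone_sum A m = dsum_pair (A 1) (dsum_family {2..m} (\<lambda>i. cone_alg (A i)))"

definition telescope :: "(nat \<Rightarrow> 'a cstar) \<Rightarrow> (nat \<Rightarrow> 'a \<Rightarrow> 'a) \<Rightarrow> nat \<Rightarrow>
    ('a \<times> (nat \<Rightarrow> real \<Rightarrow> 'a)) cstar" where
  "telescope A \<alpha> j = subalg (cone_sum A (j + 1))
     {(a, f). (a, f) \<in> carrier (cone_sum A (j + 1)) \<and>
        (\<forall>k\<in>{1..j}. f (k + 1) 1 = comp_upto \<alpha> k a)}"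

text \<open>
  The canonical regroupings that are suppressed in ordinary notation:
  \<open>(A\<^sub>1 \<oplus> CA\<^sub>2 \<oplus> \<dots> \<oplus> CA\<^bsub>m-1\<^esub>) \<oplus> CA\<^sub>m = A\<^sub>1 \<oplus> CA\<^sub>2 \<oplus> \<dots> \<oplus> CA\<^sub>m\<close> and
  \<open>(A\<^sub>1 \<oplus> CA\<^sub>2) \<oplus> (CA\<^sub>3 \<oplus> \<dots> \<oplus> CA\<^sub>m) = A\<^sub>1 \<oplus> CA\<^sub>2 \<oplus> \<dots> \<oplus> CA\<^sub>m\<close>.
\<close>

definition regroup_last ::
    "nat \<Rightarrow> ('a \<times> (nat \<Rightarrow> real \<Rightarrow> 'a)) \<times> (real \<Rightarrow> 'a) \<Rightarrow> 'a \<times> (nat \<Rightarrow> real \<Rightarrow> 'a)" where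
  "regroup_last m = (\<lambda>((a, f), g). (a, f(m := g)))"

definition regroup_first ::
    "('a \<times> (real \<Rightarrow> 'a)) \<times> (nat \<Rightarrow> real \<Rightarrow> 'a) \<Rightarrow> 'a \<times> (nat \<Rightarrow> real \<Rightarrow> 'a)" where
  "regroup_first = (\<lambda>((a, f), g). (a, g(2 := f)))"

end

theory Submission
  imports Defs
begin

text \<open>
  Exactness gives \<open>\<alpha>\<^sub>k\<^sub>+\<^sub>1 \<circ> \<alpha>\<^sub>k = 0\<close>, so every composition \<open>\<alpha>\<^sub>k \<circ> \<dots> \<circ> \<alpha>\<^sub>1\<close> with \<open>k \<ge> 2\<close> vanishes
  (\<open>comp_upto_eq_zero\<close>). The telescope condition at such a \<open>k\<close> therefore no longer links the
  component \<open>f\<^sub>k\<^sub>+\<^sub>1\<close> to \<open>a\<close>: it says that \<open>f\<^sub>k\<^sub>+\<^sub>1(1) = 0\<close>, which turns the cone \<open>CA\<^sub>k\<^sub>+\<^sub>1\<close> into the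
  suspension \<open>SA\<^sub>k\<^sub>+\<^sub>1\<close>. Only the condition \<open>f\<^sub>2(1) = \<alpha>\<^sub>1(a)\<close>, which defines the mapping cone, survives
  as a coupling.

  Both decompositions are read off inside the ambient direct sum \<open>A\<^sub>1 \<oplus> CA\<^sub>2 \<oplus> \<dots> \<oplus> CA\<^sub>n\<^sub>+\<^sub>1\<close>. Its
  two regroupings are isometric *-isomorphisms (\<open>regroup_last_iso\<close>, \<open>regroup_first_iso\<close>), and
  an isomorphism restricts to one from the preimage of a subalgebra onto that subalgebra
  (\<open>cstar_iso_subalg_preimage\<close>). It remains to recognise the preimage of the telescope as a
  direct sum of subalgebras, which is a comparison of the conditions on endpoints.
\<close>

section \<open>Subalgebras and direct sums\<close>

lemma carrier_subalg [simp]: "carrier (subalg A S) = S"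
  by (simp add: subalg_def)

lemma subalg_subalg [simp]: "subalg (subalg A S) T = subalg A T"
  by (simp add: subalg_def)

lemma carrier_dsum_pair [simp]: "carrier (dsum_pair A B) = carrier A \<times> carrier B"
  by (simp add: dsum_pair_def)

lemma carrier_dsum_family [simp]: "carrier (dsum_family I A) = (\<Pi>\<^sub>E i\<in>I. carrier (A i))"
  by (simp add: dsum_family_def)

lemma dsum_pair_subalg:
  "dsum_pair (subalg A S) (subalg B T) = subalg (dsum_pair A B) (S \<times> T)"
  by (simp add: dsum_pair_def subalg_def)

lemma dsum_family_subalg:
  "dsum_family I (\<lambda>i. subalg (A i) (S i)) = subalg (dsum_family I A) (\<Pi>\<^sub>E i\<in>I. S i)"
  by (simp add: dsum_family_def subalg_def)

lemma susp_alg_eq_subalg_cone_alg: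
  "susp_alg A = subalg (cone_alg A) {f \<in> carrier (cone_alg A). f 1 = \<zero>\<^bsub>A\<^esub>}"
  by (simp add: susp_alg_def cone_alg_def conj_assoc)

lemma cstar_iso_closed: "h \<in> cstar_iso P Q \<Longrightarrow> x \<in> carrier P \<Longrightarrow> h x \<in> carrier Q"
  by (auto simp: cstar_iso_def cstar_hom_def)

text \<open>
  An equality of subalgebras up to a canonical regrouping \<open>h\<close> has two parts: the subset is the
  image under \<open>h\<close>, and \<open>h\<close> carries the algebraic structure and the norm along. If the source is
  the preimage of \<open>S\<close>, then surjectivity of \<open>h\<close> gives the first part, and the second is a
  restriction of what holds on the whole of \<open>P\<close>.
\<close>

lemma cstar_iso_subalg_preimage:
  assumes h: "h \<in> cstar_iso P Q"
    and D: "D = subalg P {x \<in> carrier P. h x \<in> S}"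
    and S: "S \<subseteq> carrier Q"
  shows "subalg Q S = subalg Q (h ` carrier D) \<and> h \<in> cstar_iso D (subalg Q S)"
proof -
  have bij: "bij_betw h (carrier P) (carrier Q)"
    using h by (simp add: cstar_iso_def)
  have img: "h ` {x \<in> carrier P. h x \<in> S} = S"
  proof
    show "S \<subseteq> h ` {x \<in> carrier P. h x \<in> S}"
    proof
      fix y assume y: "y \<in> S"
      then obtain x where "x \<in> carrier P" "y = h x"
        using S bij_betw_imp_surj_on[OF bij] by (metis imageE subsetD)
      with y show "y \<in> h ` {x \<in> carrier P. h x \<in> S}"
        by simp
    qed
  qed auto
  have "bij_betw h {x \<in> carrier P. h x \<in> S} S"
    by (rule bij_betw_subset[OF bij _ img]) auto
  moreover have "h \<in> cstar_hom D (subalg Q S)"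
    using h unfolding D cstar_iso_def cstar_hom_def by (auto simp: subalg_def)
  moreover have "\<forall>x\<in>carrier D. cnorm (subalg Q S) (h x) = cnorm D x"
    using h unfolding D cstar_iso_def by (auto simp: subalg_def)
  ultimately show ?thesis
    using img by (simp add: D cstar_iso_def)
qed

section \<open>Regrouping the ambient direct sum\<close>

lemma bij_betw_fun_upd_PiE:
  assumes "i \<notin> I"
  shows "bij_betw (\<lambda>(f, y). f(i := y)) ((\<Pi>\<^sub>E j\<in>I. B j) \<times> B i) (\<Pi>\<^sub>E j\<in>insert i I. B j)"
proof (rule bij_betw_byWitness[where f' = "\<lambda>f. (restrict f I, f i)"])
  show "\<forall>x\<in>(\<Pi>\<^sub>E j\<in>I. B j) \<times> B i. (\<lambda>f. (restrict f I, f i)) ((\<lambda>(f, y). f(i := y)) x) = x"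
    using assms by (auto simp: fun_eq_iff restrict_def PiE_def extensional_def)
  show "\<forall>f\<in>\<Pi>\<^sub>E j\<in>insert i I. B j. (\<lambda>(f, y). f(i := y)) (restrict f I, f i) = f"
    by (auto simp: fun_eq_iff restrict_def PiE_def extensional_def)
  show "(\<lambda>(f, y). f(i := y)) ` ((\<Pi>\<^sub>E j\<in>I. B j) \<times> B i) \<subseteq> (\<Pi>\<^sub>E j\<in>insert i I. B j)"
    by (auto simp: PiE_def extensional_def split: if_splits)
  show "(\<lambda>f. (restrict f I, f i)) ` (\<Pi>\<^sub>E j\<in>insert i I. B j) \<subseteq> (\<Pi>\<^sub>E j\<in>I. B j) \<times> B i"
    by auto
qed

lemma Max_image_fun_upd:
  fixes c :: "'i \<Rightarrow> 'a \<Rightarrow> 'b :: {linorder, zero}"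
  assumes "finite I" "i \<notin> I"
  shows "Max (insert 0 ((\<lambda>j. c j ((f(i := y)) j)) ` insert i I)) =
    max (c i y) (Max (insert 0 ((\<lambda>j. c j (f j)) ` I)))"
proof -
  have "(\<lambda>j. c j ((f(i := y)) j)) ` I = (\<lambda>j. c j (f j)) ` I"
    using assms by (intro image_cong) auto
  then have "insert 0 ((\<lambda>j. c j ((f(i := y)) j)) ` insert i I) =
      insert (c i y) (insert 0 ((\<lambda>j. c j (f j)) ` I))"
    by auto
  then show ?thesis
    using assms by simp
qed

text \<open>
  Both regroupings adjoin one summand of index \<open>i\<close> to a family; they differ only in how the two
  parts are bracketed. The following is the common core.
\<close>

lemma fun_upd_iso:
  assumes "finite I" "i \<notin> I"
  shows "(\<lambda>(f, y). f(i := y)) \<in>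
    cstar_iso (dsum_pair (dsum_family I A) (A i)) (dsum_family (insert i I) A)"
proof -
  let ?h = "\<lambda>(f, y). f(i := y)"
  let ?P = "dsum_pair (dsum_family I A) (A i)" and ?Q = "dsum_family (insert i I) A"
  have bij: "bij_betw ?h (carrier ?P) (carrier ?Q)"
    using bij_betw_fun_upd_PiE[OF assms(2), of "\<lambda>j. carrier (A j)"] by simp
  have "?h \<in> carrier ?P \<rightarrow> carrier ?Q"
    using bij by (rule bij_betw_imp_funcset)
  then have "?h \<in> cstar_hom ?P ?Q"
    unfolding cstar_hom_def
    using assms(2) by (auto simp: dsum_pair_def dsum_family_def fun_eq_iff restrict_def)
  moreover have "cnorm ?Q (?h x) = cnorm ?P x" for x
  proof (cases x)
    case (Pair f y)
    show ?thesis
      using Max_image_fun_upd[OF assms, of "\<lambda>j. cnorm (A j)" f y]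
      by (simp add: Pair dsum_pair_def dsum_family_def max.commute)
  qed
  ultimately show ?thesis
    using bij unfolding cstar_iso_def by blast
qed

lemma cstar_iso_comp:
  assumes "h \<in> cstar_iso P Q" "k \<in> cstar_iso Q R"
  shows "k \<circ> h \<in> cstar_iso P R"
proof -
  have "h x \<in> carrier Q" if "x \<in> carrier P" for x
    using assms(1) that by (rule cstar_iso_closed)
  moreover have "bij_betw (k \<circ> h) (carrier P) (carrier R)"
    using assms by (auto simp: cstar_iso_def intro: bij_betw_trans)
  ultimately show ?thesis
    using assms by (auto simp: cstar_iso_def cstar_hom_def Pi_iff)
qed

lemma dsum_pair_right_iso:
  assumes "h \<in> cstar_iso B C"
  shows "map_prod id h \<in> cstar_iso (dsum_pair A B) (dsum_pair A C)"
proof -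
  have "bij_betw (map_prod id h) (carrier A \<times> carrier B) (carrier A \<times> carrier C)"
    using assms by (intro bij_betw_map_prod) (auto simp: cstar_iso_def)
  then show ?thesis
    using assms by (auto simp: cstar_iso_def cstar_hom_def dsum_pair_def Pi_iff)
qed

lemma dsum_pair_assoc_iso:
  "(\<lambda>((a, b), c). (a, b, c)) \<in>
    cstar_iso (dsum_pair (dsum_pair A B) C) (dsum_pair A (dsum_pair B C))"
proof -
  have "bij_betw (\<lambda>((a, b), c). (a, b, c)) ((carrier A \<times> carrier B) \<times> carrier C)
      (carrier A \<times> carrier B \<times> carrier C)"
    by (rule bij_betw_byWitness[where f' = "\<lambda>(a, b, c). ((a, b), c)"]) auto
  then show ?thesis
    by (auto simp: cstar_iso_def cstar_hom_def dsum_pair_def max.assoc)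
qed

lemma dsum_pair_swap_iso: "prod.swap \<in> cstar_iso (dsum_pair A B) (dsum_pair B A)"
proof -
  have "bij_betw prod.swap (carrier A \<times> carrier B) (carrier B \<times> carrier A)"
    by (rule bij_betw_byWitness[where f' = prod.swap]) auto
  then show ?thesis
    by (auto simp: cstar_iso_def cstar_hom_def dsum_pair_def max.commute)
qed

lemma regroup_last_iso:
  assumes "1 \<le> m"
  shows "regroup_last (m + 1) \<in>
    cstar_iso (dsum_pair (cone_sum A m) (cone_alg (A (m + 1)))) (cone_sum A (m + 1))"
proof -
  have "insert (m + 1) {2..m} = {2..m + 1}"
    using assms by auto
  then have upd: "(\<lambda>(f, y). f(m + 1 := y)) \<in> cstar_iso
      (dsum_pair (dsum_family {2..m} (\<lambda>i. cone_alg (A i))) (cone_alg (A (m + 1))))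
      (dsum_family {2..m + 1} (\<lambda>i. cone_alg (A i)))"
    using fun_upd_iso[of "{2..m}" "m + 1" "\<lambda>i. cone_alg (A i)"] by simp
  have eq: "regroup_last (m + 1) = map_prod id (\<lambda>(f, y). f(m + 1 := y)) \<circ> (\<lambda>((a, b), c). (a, b, c))"
    by (auto simp: regroup_last_def fun_eq_iff)
  show ?thesis
    unfolding eq cone_sum_def
    by (rule cstar_iso_comp[OF dsum_pair_assoc_iso dsum_pair_right_iso[OF upd]])
qed

lemma regroup_first_iso:
  assumes "2 \<le> m"
  shows "regroup_first \<in> cstar_iso
    (dsum_pair (dsum_pair (A 1) (cone_alg (A 2))) (dsum_family {3..m} (\<lambda>i. cone_alg (A i))))
    (cone_sum A m)"
proof -
  have "insert 2 {3..m} = {2..m}"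
    using assms by auto
  then have upd: "(\<lambda>(f, y). f(2 := y)) \<in> cstar_iso
      (dsum_pair (dsum_family {3..m} (\<lambda>i. cone_alg (A i))) (cone_alg (A 2)))
      (dsum_family {2..m} (\<lambda>i. cone_alg (A i)))"
    using fun_upd_iso[of "{3..m}" 2 "\<lambda>i. cone_alg (A i)"] by simp
  have eq: "regroup_first =
      map_prod id ((\<lambda>(f, y). f(2 := y)) \<circ> prod.swap) \<circ> (\<lambda>((a, b), c). (a, b, c))"
    by (auto simp: regroup_first_def fun_eq_iff)
  show ?thesis
    unfolding eq cone_sum_def
    by (rule cstar_iso_comp[OF dsum_pair_assoc_iso
          dsum_pair_right_iso[OF cstar_iso_comp[OF dsum_pair_swap_iso upd]]])
qed

section \<open>Compositions along an exact sequence\<close>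

lemma comp_upto_closed:
  assumes "\<And>k. k \<in> {1..n} \<Longrightarrow> \<alpha> k \<in> carrier (A k) \<rightarrow> carrier (A (k + 1))"
    and "a \<in> carrier (A 1)" "k \<le> n"
  shows "comp_upto \<alpha> k a \<in> carrier (A (k + 1))"
  using assms(3)
proof (induction k)
  case 0
  then show ?case
    using assms(2) by simp
next
  case (Suc k)
  then show ?case
    using assms(1)[of "Suc k"] by auto
qed

text \<open>
  The last two factors already compose to zero: the inner one lands in its image, which by
  exactness is the kernel of the outer one.
\<close>

lemma comp_upto_eq_zero:
  assumes maps: "\<And>k. k \<in> {1..n} \<Longrightarrow> \<alpha> k \<in> carrier (A k) \<rightarrow> carrier (A (k + 1))"
    and exact: "\<And>k. k \<in> {1..n - 1} \<Longrightarrow>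
      a_kernel (A (k + 1)) (A (k + 2)) (\<alpha> (k + 1)) = \<alpha> k ` carrier (A k)"
    and a: "a \<in> carrier (A 1)" and k: "2 \<le> k" "k \<le> n"
  shows "comp_upto \<alpha> k a = \<zero>\<^bsub>A (k + 1)\<^esub>"
proof -
  obtain j where j: "k = Suc (Suc j)"
    using k(1) by (metis Suc_le_D numeral_2_eq_2 Suc_le_mono)
  have "comp_upto \<alpha> j a \<in> carrier (A (j + 1))"
    using comp_upto_closed[of n \<alpha> A a j, OF maps a] k j by simp
  moreover have "a_kernel (A (j + 1 + 1)) (A (j + 1 + 2)) (\<alpha> (j + 1 + 1)) =
      \<alpha> (j + 1) ` carrier (A (j + 1))"
    using k j by (intro exact) auto
  ultimately have "\<alpha> (j + 1) (comp_upto \<alpha> j a) \<in>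
      a_kernel (A (j + 1 + 1)) (A (j + 1 + 2)) (\<alpha> (j + 1 + 1))"
    by simp
  then show ?thesis
    by (simp add: a_kernel_def' j)
qed

section \<open>Splitting the telescope\<close>

theorem corollary5p10:
  fixes n :: nat and A :: "nat \<Rightarrow> 'a cstar" and \<alpha> :: "nat \<Rightarrow> 'a \<Rightarrow> 'a"
  assumes "2 \<le> n"
    and "\<And>i. i \<in> {1..n + 1} \<Longrightarrow> cstar_algebra (A i)"
    and "\<And>k. k \<in> {1..n} \<Longrightarrow> \<alpha> k \<in> cstar_hom (A k) (A (k + 1))"
    and "\<And>k. k \<in> {1..n - 1} \<Longrightarrow>
      a_kernel (A (k + 1)) (A (k + 2)) (\<alpha> (k + 1)) = \<alpha> k ` carrier (A k)"
  shows
    "(let D = dsum_pair (telescope A \<alpha> (n - 1)) (susp_alg (A (n + 1)))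
      in telescope A \<alpha> n = subalg (cone_sum A (n + 1)) (regroup_last (n + 1) ` carrier D) \<and>
         regroup_last (n + 1) \<in> cstar_iso D (telescope A \<alpha> n)) \<and>
     (let D = dsum_pair (mapping_cone (A 1) (A 2) (\<alpha> 1)) (dsum_family {3..n + 1} (\<lambda>i. susp_alg (A i)))
      in telescope A \<alpha> n = subalg (cone_sum A (n + 1)) (regroup_first ` carrier D) \<and>
         regroup_first \<in> cstar_iso D (telescope A \<alpha> n))"
proof -
  have maps: "\<alpha> k \<in> carrier (A k) \<rightarrow> carrier (A (k + 1))" if "k \<in> {1..n}" for k
    using assms(3)[OF that] by (simp add: cstar_hom_def)
  have zero: "comp_upto \<alpha> k a = \<zero>\<^bsub>A (k + 1)\<^esub>" if "a \<in> carrier (A 1)" "2 \<le> k" "k \<le> n" for k a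
    using maps assms(4) that by (rule comp_upto_eq_zero)
  define S where "S j = {(a, f). (a, f) \<in> carrier (cone_sum A (j + 1)) \<and>
      (\<forall>k\<in>{1..j}. f (k + 1) 1 = comp_upto \<alpha> k a)}" for j
  have telescope: "telescope A \<alpha> j = subalg (cone_sum A (j + 1)) (S j)" for j
    by (simp add: telescope_def S_def)
  have S_subset: "S n \<subseteq> carrier (cone_sum A (n + 1))"
    by (auto simp: S_def)

  define D where "D = dsum_pair (telescope A \<alpha> (n - 1)) (susp_alg (A (n + 1)))"
  define P where "P = dsum_pair (cone_sum A n) (cone_alg (A (n + 1)))"
  have iso: "regroup_last (n + 1) \<in> cstar_iso P (cone_sum A (n + 1))"
    unfolding P_def using assms(1) by (intro regroup_last_iso) simp
  \<comment> \<open>Of the conditions defining \<open>S n\<close>, only the one at \<open>k = n\<close> concerns \<open>g\<close>; since the composition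
    of all \<open>n\<close> maps is zero, it says exactly that the path \<open>g\<close> lies in the suspension.\<close>
  have mem: "regroup_last (n + 1) ((a, f), g) \<in> S n \<longleftrightarrow> (a, f) \<in> S (n - 1) \<and> g 1 = \<zero>\<^bsub>A (n + 1)\<^esub>"
    if x: "((a, f), g) \<in> carrier P" for a f g
  proof -
    have "(a, f(n + 1 := g)) \<in> carrier (cone_sum A (n + 1))"
      using cstar_iso_closed[OF iso x] by (simp add: regroup_last_def)
    moreover have "{1..n} = insert n {1..n - 1}"
      using assms(1) by auto
    moreover have "comp_upto \<alpha> n a = \<zero>\<^bsub>A (n + 1)\<^esub>"
      using x assms(1) by (intro zero) (auto simp: P_def cone_sum_def)
    ultimately show ?thesis
      using x assms(1) by (auto simp: S_def P_def regroup_last_def)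
  qed
  have "carrier D = {x \<in> carrier P. regroup_last (n + 1) x \<in> S n}"
  proof (rule Set.set_eqI)
    fix x :: "('a \<times> (nat \<Rightarrow> real \<Rightarrow> 'a)) \<times> (real \<Rightarrow> 'a)"
    obtain a f g where x: "x = ((a, f), g)"
      by (metis surj_pair)
    have "S (n - 1) \<subseteq> carrier (cone_sum A n)"
      using assms(1) by (auto simp: S_def)
    then have "x \<in> carrier D \<longleftrightarrow> x \<in> carrier P \<and> (a, f) \<in> S (n - 1) \<and> g 1 = \<zero>\<^bsub>A (n + 1)\<^esub>"
      by (auto simp: x D_def P_def telescope susp_alg_eq_subalg_cone_alg)
    then show "x \<in> carrier D \<longleftrightarrow> x \<in> {x \<in> carrier P. regroup_last (n + 1) x \<in> S n}"
      using mem x by auto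
  qed
  moreover have "D = subalg P (carrier D)"
    using assms(1) by (simp add: D_def P_def telescope susp_alg_eq_subalg_cone_alg dsum_pair_subalg)
  ultimately have "D = subalg P {x \<in> carrier P. regroup_last (n + 1) x \<in> S n}"
    by simp
  then have last: "telescope A \<alpha> n = subalg (cone_sum A (n + 1)) (regroup_last (n + 1) ` carrier D) \<and>
      regroup_last (n + 1) \<in> cstar_iso D (telescope A \<alpha> n)"
    unfolding telescope by (intro cstar_iso_subalg_preimage[OF iso _ S_subset])

  define E where "E = dsum_pair (mapping_cone (A 1) (A 2) (\<alpha> 1))
      (dsum_family {3..n + 1} (\<lambda>i. susp_alg (A i)))"
  define R where "R = dsum_pair (dsum_pair (A 1) (cone_alg (A 2)))
      (dsum_family {3..n + 1} (\<lambda>i. cone_alg (A i)))"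
  have iso': "regroup_first \<in> cstar_iso R (cone_sum A (n + 1))"
    unfolding R_def using assms(1) by (intro regroup_first_iso) simp
  \<comment> \<open>The condition at \<open>k = 1\<close> is the one of the mapping cone; each condition at \<open>k \<ge> 2\<close> has
    right-hand side zero and so involves a single summand.\<close>
  have mem': "regroup_first ((a, f), g) \<in> S n \<longleftrightarrow>
      f 1 = \<alpha> 1 a \<and> (\<forall>i\<in>{3..n + 1}. g i 1 = \<zero>\<^bsub>A i\<^esub>)"
    if x: "((a, f), g) \<in> carrier R" for a f g
  proof -
    have "(a, g(2 := f)) \<in> carrier (cone_sum A (n + 1))"
      using cstar_iso_closed[OF iso' x] by (simp add: regroup_first_def)
    moreover have "{1..n} = insert 1 {2..n}"
      using assms(1) by auto
    moreover have "comp_upto \<alpha> k a = \<zero>\<^bsub>A (k + 1)\<^esub>" if "k \<in> {2..n}" for k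
      using x that by (intro zero) (auto simp: R_def)
    moreover have "(\<forall>i\<in>{3..n + 1}. g i 1 = \<zero>\<^bsub>A i\<^esub>) \<longleftrightarrow>
        (\<forall>k\<in>{2..n}. g (k + 1) 1 = \<zero>\<^bsub>A (k + 1)\<^esub>)"
    proof -
      have shift: "{3..n + 1} = (\<lambda>k. k + 1) ` {2..n}"
        by (simp add: image_add_atLeastAtMost')
      show ?thesis
        by (simp only: shift ball_simps)
    qed
    ultimately show ?thesis
      by (simp add: S_def regroup_first_def)
  qed
  have "carrier E = {x \<in> carrier R. regroup_first x \<in> S n}"
  proof (rule Set.set_eqI)
    fix x :: "('a \<times> (real \<Rightarrow> 'a)) \<times> (nat \<Rightarrow> real \<Rightarrow> 'a)"
    obtain a f g where x: "x = ((a, f), g)"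
      by (metis surj_pair)
    have "x \<in> carrier E \<longleftrightarrow> x \<in> carrier R \<and> f 1 = \<alpha> 1 a \<and> (\<forall>i\<in>{3..n + 1}. g i 1 = \<zero>\<^bsub>A i\<^esub>)"
      by (auto simp: x E_def R_def mapping_cone_def susp_alg_eq_subalg_cone_alg PiE_iff)
    then show "x \<in> carrier E \<longleftrightarrow> x \<in> {x \<in> carrier R. regroup_first x \<in> S n}"
      using mem' x by auto
  qed
  moreover have "E = subalg R (carrier E)"
    by (simp add: E_def R_def mapping_cone_def susp_alg_eq_subalg_cone_alg dsum_family_subalg
        dsum_pair_subalg)
  ultimately have "E = subalg R {x \<in> carrier R. regroup_first x \<in> S n}"
    by simp
  then have first: "telescope A \<alpha> n = subalg (cone_sum A (n + 1)) (regroup_first ` carrier E) \<and>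
      regroup_first \<in> cstar_iso E (telescope A \<alpha> n)"
    unfolding telescope by (intro cstar_iso_subalg_preimage[OF iso' _ S_subset])
  show ?thesis
    using last first unfolding D_def E_def Let_def by (rule conjI)
qed

end
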